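(* Let $n\ge3$ be an integer, let $D_n=\langle a,b\mid a^n=b^2=1,\ ab=ba^{-1}\rangle$ be the dihedral group of order $2n$ and $Q_n=\langle a,b\mid a^{2n}=b^4=1,\ b^2=a^n,\ ab=ba^{-1}\rangle$ the generalized quaternion (dicyclic) group of order $4n$. Then $\Gamma_N(Q_n)\cong\Gamma_N(D_n)$.
   Context: $\Gamma_N(G)$ denotes the simple graph whose vertices are the proper non-normal subgroups of the group $G$, two distinct vertices $H,K$ being adjacent iff $HK=KH$. *)

theory Defs
  imports "HOL-Algebra.Coset" "Graph_Theory.Digraph_Isomorphism" "Graph_Theory.Pair_Digraph"
begin

text \<open>
  The generating set is the whole type \<open>'g\<close>. Words are finite sequences of generators and
  formal inverses of generators; a relation \<open>u = v\<close> is the pair \<open>(u, v)\<close> of words. The presented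
  group consists of the classes of words modulo the least congruence that contains
  the relations and the cancellations \<open>x x\<^sup>-\<^sup>1 = x\<^sup>-\<^sup>1 x = 1\<close>, i.e. it is the free group modulo
  the normal closure of the elements \<open>u v\<^sup>-\<^sup>1\<close>.
\<close>

datatype 'g letter = Gen 'g | GenInv 'g

inductive word_eq :: "('g letter list \<times> 'g letter list) set \<Rightarrow> 'g letter list \<Rightarrow> 'g letter list \<Rightarrow> bool"
  for R where
  rel: "(u, v) \<in> R \<Longrightarrow> word_eq R u v"
| cancel: "word_eq R [Gen x, GenInv x] []"
| cancel': "word_eq R [GenInv x, Gen x] []"
| refl: "word_eq R u u"
| sym: "word_eq R u v \<Longrightarrow> word_eq R v u"
| trans: "word_eq R u v \<Longrightarrow> word_eq R v w \<Longrightarrow> word_eq R u w"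
| append: "word_eq R u u' \<Longrightarrow> word_eq R v v' \<Longrightarrow> word_eq R (u @ v) (u' @ v')"

definition word_class :: "('g letter list \<times> 'g letter list) set \<Rightarrow> 'g letter list \<Rightarrow> 'g letter list set"
  where "word_class R u = {v. word_eq R u v}"

definition presented_group ::
  "('g letter list \<times> 'g letter list) set \<Rightarrow> 'g letter list set monoid" where
  "presented_group R =
     \<lparr> carrier = range (word_class R),
       monoid.mult = (\<lambda>S T. \<Union>u\<in>S. \<Union>v\<in>T. word_class R (u @ v)),
       monoid.one = word_class R [] \<rparr>"

lemma word_class_eq_iff: "word_class R u = word_class R v \<longleftrightarrow> word_eq R u v"
  unfolding word_class_def by (auto intro: word_eq.intros)

lemma presented_group_mult:
  "word_class R u \<otimes>\<^bsub>presented_group R\<^esub> word_class R v = word_class R (u @ v)"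
  unfolding presented_group_def word_class_def by (auto intro: word_eq.intros)

fun inv_letter :: "'g letter \<Rightarrow> 'g letter" where
  "inv_letter (Gen x) = GenInv x"
| "inv_letter (GenInv x) = Gen x"

lemma word_eq_inverse: "word_eq R (rev (map inv_letter u) @ u) []"
proof (induction u)
  case Nil
  show ?case by (simp add: word_eq.refl)
next
  case (Cons x u)
  have "word_eq R [inv_letter x, x] []"
    by (cases x) (auto intro: word_eq.cancel word_eq.cancel')
  from word_eq.append[OF this word_eq.refl[of R u]]
  have "word_eq R (rev (map inv_letter u) @ [inv_letter x, x] @ u) (rev (map inv_letter u) @ u)"
    by (intro word_eq.append word_eq.refl) simp
  with Cons.IH show ?case by (auto intro: word_eq.trans)
qed

lemma group_presented_group: "group (presented_group R)"
proof (rule groupI)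
  have carr: "carrier (presented_group R) = range (word_class R)"
    and one: "\<one>\<^bsub>presented_group R\<^esub> = word_class R []"
    by (auto simp: presented_group_def)
  show "\<one>\<^bsub>presented_group R\<^esub> \<in> carrier (presented_group R)" by (simp add: carr one)
  fix x assume x: "x \<in> carrier (presented_group R)"
  then show "\<one>\<^bsub>presented_group R\<^esub> \<otimes>\<^bsub>presented_group R\<^esub> x = x"
    by (auto simp: carr one presented_group_mult)
  from x obtain u where u: "x = word_class R u" by (auto simp: carr)
  have "word_class R (rev (map inv_letter u)) \<otimes>\<^bsub>presented_group R\<^esub> x = \<one>\<^bsub>presented_group R\<^esub>"
    by (simp add: u one presented_group_mult word_class_eq_iff word_eq_inverse)
  then show "\<exists>y\<in>carrier (presented_group R). y \<otimes>\<^bsub>presented_group R\<^esub> x = \<one>\<^bsub>presented_group R\<^esub>"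
    by (auto simp: carr)
  fix y assume y: "y \<in> carrier (presented_group R)"
  with x show "x \<otimes>\<^bsub>presented_group R\<^esub> y \<in> carrier (presented_group R)"
    by (auto simp: carr presented_group_mult)
  fix z assume "z \<in> carrier (presented_group R)"
  with x y show "x \<otimes>\<^bsub>presented_group R\<^esub> y \<otimes>\<^bsub>presented_group R\<^esub> z
      = x \<otimes>\<^bsub>presented_group R\<^esub> (y \<otimes>\<^bsub>presented_group R\<^esub> z)"
    by (auto simp: carr presented_group_mult)
qed

datatype gen = gen_a | gen_b

definition dihedral_group :: "nat \<Rightarrow> gen letter list set monoid" where
  "dihedral_group n = presented_group
     {(replicate n (Gen gen_a), []),
      (replicate 2 (Gen gen_b), []),
      ([Gen gen_a, Gen gen_b], [Gen gen_b, GenInv gen_a])}"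

definition quaternion_group :: "nat \<Rightarrow> gen letter list set monoid" where
  "quaternion_group n = presented_group
     {(replicate (2 * n) (Gen gen_a), []),
      (replicate 4 (Gen gen_b), []),
      (replicate 2 (Gen gen_b), replicate n (Gen gen_a)),
      ([Gen gen_a, Gen gen_b], [Gen gen_b, GenInv gen_a])}"

definition proper_nonnormal_subgroups :: "('a, 'm) monoid_scheme \<Rightarrow> 'a set set" where
  "proper_nonnormal_subgroups G = {H. subgroup H G \<and> H \<noteq> carrier G \<and> \<not> H \<lhd> G}"

text \<open>
  Simple graphs are symmetric loop-free pair digraphs: an edge \<open>{H, K}\<close> is
  represented by the two arcs \<open>(H, K)\<close> and \<open>(K, H)\<close>.
\<close>

definition Gamma_N :: "('a, 'm) monoid_scheme \<Rightarrow> 'a set pair_pre_digraph" where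
  "Gamma_N G =
     \<lparr> pverts = proper_nonnormal_subgroups G,
       parcs = {(H, K). H \<in> proper_nonnormal_subgroups G \<and> K \<in> proper_nonnormal_subgroups G
                  \<and> H \<noteq> K \<and> H <#>\<^bsub>G\<^esub> K = K <#>\<^bsub>G\<^esub> H} \<rparr>"

lemma pair_bidirected_digraph_Gamma_N: "pair_bidirected_digraph (Gamma_N G)"
  by unfold_locales (auto simp: Gamma_N_def symmetric_def intro!: symI)

text \<open>
  On pair digraphs, \<open>digraph_iso\<close> is the usual notion of graph isomorphism.
\<close>

lemma digraph_iso_with_proj_iff:
  assumes "pair_wf_digraph G" "pair_wf_digraph H"
  shows "digraph_iso (with_proj G) (with_proj H) \<longleftrightarrow>
    (\<exists>f. bij_betw f (pverts G) (pverts H) \<and>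
         (\<forall>u\<in>pverts G. \<forall>v\<in>pverts G. (u, v) \<in> parcs G \<longleftrightarrow> (f u, f v) \<in> parcs H))"
proof
  interpret G: pair_wf_digraph G by fact
  assume "digraph_iso (with_proj G) (with_proj H)"
  then obtain h where h: "pre_digraph.digraph_isomorphism (with_proj G) h"
    and H: "with_proj H = app_iso h (with_proj G)"
    unfolding digraph_iso_def by blast
  let ?f = "iso_verts h"
  have inj: "inj_on ?f (pverts G)"
    using h by (simp add: pre_digraph.digraph_isomorphism_def)
  have V: "pverts H = ?f ` pverts G" and A: "parcs H = iso_arcs h ` parcs G"
    and T: "iso_tail h = fst" "iso_head h = snd"
    using H by (auto simp: with_proj_def app_iso_def)
  have arcs: "iso_arcs h (u, v) = (?f u, ?f v)" if "(u, v) \<in> parcs G" for u v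
    using h that T unfolding pre_digraph.digraph_isomorphism_def
    by (auto intro!: prod_eqI)
  have "(u, v) \<in> parcs G \<longleftrightarrow> (?f u, ?f v) \<in> parcs H" if uv: "u \<in> pverts G" "v \<in> pverts G" for u v
  proof
    assume "(u, v) \<in> parcs G"
    then show "(?f u, ?f v) \<in> parcs H" using arcs A by force
  next
    assume "(?f u, ?f v) \<in> parcs H"
    then obtain x y where xy: "(x, y) \<in> parcs G" "iso_arcs h (x, y) = (?f u, ?f v)"
      using A by force
    then have "?f x = ?f u" "?f y = ?f v" using arcs by auto
    with xy uv inj G.wellformed' show "(u, v) \<in> parcs G" by (metis inj_onD)
  qed
  with inj V show "\<exists>f. bij_betw f (pverts G) (pverts H) \<and>
      (\<forall>u\<in>pverts G. \<forall>v\<in>pverts G. (u, v) \<in> parcs G \<longleftrightarrow> (f u, f v) \<in> parcs H)"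
    by (auto simp: bij_betw_def)
next
  interpret G: pair_wf_digraph G by fact
  interpret H: pair_wf_digraph H by fact
  assume "\<exists>f. bij_betw f (pverts G) (pverts H) \<and>
    (\<forall>u\<in>pverts G. \<forall>v\<in>pverts G. (u, v) \<in> parcs G \<longleftrightarrow> (f u, f v) \<in> parcs H)"
  then obtain f where f: "inj_on f (pverts G)" "f ` pverts G = pverts H"
    "\<And>u v. u \<in> pverts G \<Longrightarrow> v \<in> pverts G \<Longrightarrow> (u, v) \<in> parcs G \<longleftrightarrow> (f u, f v) \<in> parcs H"
    by (auto simp: bij_betw_def)
  let ?h = "\<lparr> iso_verts = f, iso_arcs = map_prod f f, iso_head = snd, iso_tail = fst \<rparr>"
  have "inj_on (map_prod f f) (parcs G)"
  proof (rule inj_onI, clarsimp)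
    fix u v x y
    assume "(u, v) \<in> parcs G" "(x, y) \<in> parcs G" "f u = f x" "f v = f y"
    then show "u = x \<and> v = y"
      using f(1) G.in_arcsD1 G.in_arcsD2 by (metis inj_onD)
  qed
  then have "pre_digraph.digraph_isomorphism (with_proj G) ?h"
    using f(1) assms(1) by (simp add: pre_digraph.digraph_isomorphism_def wf_digraph_wp_iff)
  moreover have "map_prod f f ` parcs G = parcs H"
  proof
    show "map_prod f f ` parcs G \<subseteq> parcs H"
    proof (rule image_subsetI)
      fix e assume e: "e \<in> parcs G"
      obtain u v where uv: "e = (u, v)" by (cases e)
      then have "u \<in> pverts G" "v \<in> pverts G" using e G.in_arcsD1 G.in_arcsD2 by blast+
      then have "(f u, f v) \<in> parcs H" using e uv f(3) by blast
      then show "map_prod f f e \<in> parcs H" by (simp add: uv)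
    qed
    show "parcs H \<subseteq> map_prod f f ` parcs G"
    proof (rule subrelI)
      fix x y assume xy: "(x, y) \<in> parcs H"
      then have "x \<in> f ` pverts G" "y \<in> f ` pverts G"
        using f(2) H.in_arcsD1 H.in_arcsD2 by simp_all
      then obtain u v where uv: "u \<in> pverts G" "v \<in> pverts G" "x = f u" "y = f v"
        by (elim imageE)
      then have "(u, v) \<in> parcs G" using xy f(3) by blast
      then have "map_prod f f (u, v) \<in> map_prod f f ` parcs G" by (rule imageI)
      with uv show "(x, y) \<in> map_prod f f ` parcs G" by simp
    qed
  qed
  then have "with_proj H = app_iso ?h (with_proj G)"
    using f(2) by (simp add: with_proj_def app_iso_def)
  ultimately show "digraph_iso (with_proj G) (with_proj H)"
    unfolding digraph_iso_def by blast
qed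

end

theory Submission
  imports Defs "HOL-Algebra.Generated_Groups"
begin

text \<open>
  The dihedral group is the quotient of the dicyclic group by its central subgroup \<open>{1, a\<^sup>n}\<close>.
  A non-normal subgroup of the dicyclic group is not contained in \<open>\<langle>a\<rangle>\<close>, since all subgroups
  of \<open>\<langle>a\<rangle>\<close> are normal; so it contains some \<open>a\<^sup>i b\<close> and hence \<open>(a\<^sup>i b)\<^sup>2 = b\<^sup>2 = a\<^sup>n\<close>. Thus
  every vertex contains the kernel, and the correspondence theorem gives the isomorphism.
  That the kernel is no larger than \<open>{1, a\<^sup>n}\<close> is an induction on derivations: each dihedral
  relation holds in the dicyclic group up to the central element \<open>a\<^sup>n\<close>, so no model of
  either group is needed.
\<close>

section \<open>Permutability graphs and quotients\<close>

context group_hom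
begin

text \<open>If \<open>h x = h y\<close> with \<open>y\<close> in \<open>A\<close>, then
  \<open>inv y \<otimes> x\<close> lies in the kernel, hence in \<open>A\<close>. So
  \<open>A\<close> is the full preimage of its image, and membership in \<open>A\<close> can be
  tested after applying \<open>h\<close>.\<close>

lemma mem_if_hom_mem_image:
  assumes "subgroup A G" "kernel G H h \<subseteq> A" "x \<in> carrier G" "h x \<in> h ` A"
  shows "x \<in> A"
proof -
  from assms(4) obtain y where y: "y \<in> A" "h x = h y" by blast
  then have yc: "y \<in> carrier G" using assms(1) subgroup.subset by blast
  then have "inv y \<otimes> x \<in> kernel G H h"
    using assms(3) y(2) by (simp add: kernel_def H.l_inv)
  then have "y \<otimes> (inv y \<otimes> x) \<in> A"
    using assms(1,2) y(1) by (meson subgroup.m_closed subsetD)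
  then show ?thesis using yc assms(3) by (simp add: G.m_assoc[symmetric])
qed

text \<open>Conjugates are transported along \<open>h\<close>: from left to right the kernel
  condition pulls membership back to \<open>A\<close>; from right to left surjectivity makes every
  conjugating element of \<open>H\<close> an image.\<close>

lemma normal_image_iff:
  assumes "subgroup A G" "kernel G H h \<subseteq> A" "h ` carrier G = carrier H"
  shows "h ` A \<lhd> H \<longleftrightarrow> A \<lhd> G"
proof
  assume n: "h ` A \<lhd> H"
  have "x \<otimes> y \<otimes> inv x \<in> A" if x: "x \<in> carrier G" and y: "y \<in> A" for x y
  proof (rule mem_if_hom_mem_image[OF assms(1,2)])
    have yc: "y \<in> carrier G" using assms(1) y subgroup.subset by blast
    show "x \<otimes> y \<otimes> inv x \<in> carrier G" using x yc by simp
    show "h (x \<otimes> y \<otimes> inv x) \<in> h ` A"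
      using n x y yc normal.inv_op_closed2[OF n, of "h x" "h y"] by simp
  qed
  then show "A \<lhd> G" using assms(1) by (simp add: G.normal_inv_iff)
next
  assume n: "A \<lhd> G"
  have "h x \<otimes>\<^bsub>H\<^esub> h y \<otimes>\<^bsub>H\<^esub> inv\<^bsub>H\<^esub> h x \<in> h ` A" if x: "x \<in> carrier G" and y: "y \<in> A" for x y
  proof -
    have yc: "y \<in> carrier G" using assms(1) y subgroup.subset by blast
    have "h x \<otimes>\<^bsub>H\<^esub> h y \<otimes>\<^bsub>H\<^esub> inv\<^bsub>H\<^esub> h x = h (x \<otimes> y \<otimes> inv x)" using x yc by simp
    then show ?thesis using normal.inv_op_closed2[OF n x y] by simp
  qed
  then show "h ` A \<lhd> H"
    using assms subgroup_img_is_subgroup[OF assms(1)]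
    by (auto simp: H.normal_inv_iff assms(3)[symmetric])
qed

lemma set_mult_image:
  assumes "A \<subseteq> carrier G" "B \<subseteq> carrier G"
  shows "h ` (A <#> B) = h ` A <#>\<^bsub>H\<^esub> h ` B"
  using set_mult_hom[OF homh assms] .

text \<open>If \<open>h x = h (c \<otimes> d)\<close> with \<open>c\<close> in \<open>B\<close> and
  \<open>d\<close> in \<open>A\<close>, the kernel ambiguity is absorbed by the right factor:
  \<open>inv c \<otimes> x\<close> has the same image as \<open>d\<close>, so it lies in
  \<open>A\<close>. Applied twice, with \<open>A\<close> and \<open>B\<close> exchanged, this
  reflects permutability.\<close>

lemma set_mult_subset_if_image_subset:
  assumes "subgroup A G" "subgroup B G" "kernel G H h \<subseteq> A"
    and "h ` (A <#> B) \<subseteq> h ` (B <#> A)"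
  shows "A <#> B \<subseteq> B <#> A"
proof
  fix x assume x: "x \<in> A <#> B"
  have AB: "A \<subseteq> carrier G" "B \<subseteq> carrier G" using assms(1,2) subgroup.subset by blast+
  with x have xc: "x \<in> carrier G" using G.set_mult_closed by blast
  from x assms(4) obtain c d where cd: "c \<in> B" "d \<in> A" "h x = h (c \<otimes> d)"
    unfolding set_mult_def by blast
  then have cdc: "c \<in> carrier G" "d \<in> carrier G" using AB by auto
  have "inv c \<otimes> x \<in> A"
  proof (rule mem_if_hom_mem_image[OF assms(1,3)])
    show "inv c \<otimes> x \<in> carrier G" using cdc xc by simp
    have "h (inv c \<otimes> x) = h d" using cd(3) cdc xc by (simp add: H.m_assoc[symmetric])
    then show "h (inv c \<otimes> x) \<in> h ` A" using cd(2) by simp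
  qed
  moreover have "x = c \<otimes> (inv c \<otimes> x)" using cdc xc by (simp add: G.m_assoc[symmetric])
  ultimately show "x \<in> B <#> A" using cd(1) unfolding set_mult_def by blast
qed

lemma permutable_image_iff:
  assumes "subgroup A G" "subgroup B G" "kernel G H h \<subseteq> A" "kernel G H h \<subseteq> B"
  shows "h ` A <#>\<^bsub>H\<^esub> h ` B = h ` B <#>\<^bsub>H\<^esub> h ` A \<longleftrightarrow> A <#> B = B <#> A"
proof -
  have AB: "A \<subseteq> carrier G" "B \<subseteq> carrier G" using assms(1,2) subgroup.subset by blast+
  have "A <#> B = B <#> A" if "h ` (A <#> B) = h ` (B <#> A)"
    by (intro equalityI set_mult_subset_if_image_subset assms) (simp_all add: that)
  then show ?thesis
    unfolding set_mult_image[OF AB, symmetric] set_mult_image[OF AB(2,1), symmetric] by auto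
qed

lemma inj_on_image_proper_nonnormal_subgroups:
  assumes "\<And>A. A \<in> proper_nonnormal_subgroups G \<Longrightarrow> kernel G H h \<subseteq> A"
  shows "inj_on ((`) h) (proper_nonnormal_subgroups G)"
proof (rule inj_onI)
  fix A B assume AB: "A \<in> proper_nonnormal_subgroups G" "B \<in> proper_nonnormal_subgroups G"
    and e: "h ` A = h ` B"
  then have s: "subgroup A G" "subgroup B G" by (auto simp: proper_nonnormal_subgroups_def)
  then have c: "A \<subseteq> carrier G" "B \<subseteq> carrier G" using subgroup.subset by blast+
  show "A = B"
  proof (intro equalityI subsetI)
    fix x assume "x \<in> A"
    then show "x \<in> B"
      using mem_if_hom_mem_image[OF s(2) assms[OF AB(2)]] e c(1) by blast
  next
    fix x assume "x \<in> B"
    then show "x \<in> A"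
      using mem_if_hom_mem_image[OF s(1) assms[OF AB(1)]] e c(2) by blast
  qed
qed

text \<open>Each vertex of the second graph is the image of its preimage under \<open>h\<close>,
  which contains the kernel. Properness comes for free on both sides, because the whole group is
  normal in itself.\<close>

lemma image_proper_nonnormal_subgroups:
  assumes surj: "h ` carrier G = carrier H"
    and ker: "\<And>A. A \<in> proper_nonnormal_subgroups G \<Longrightarrow> kernel G H h \<subseteq> A"
  shows "(`) h ` proper_nonnormal_subgroups G = proper_nonnormal_subgroups H"
proof (intro equalityI subsetI)
  fix B assume "B \<in> (`) h ` proper_nonnormal_subgroups G"
  then obtain A where A: "A \<in> proper_nonnormal_subgroups G" "B = h ` A" by blast
  then have s: "subgroup A G" "A \<noteq> carrier G" "\<not> A \<lhd> G"
    by (auto simp: proper_nonnormal_subgroups_def)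
  have "subgroup B H" using s(1) A(2) subgroup_img_is_subgroup by blast
  moreover have nB: "\<not> B \<lhd> H" using normal_image_iff[OF s(1) ker[OF A(1)] surj] s(3) A(2) by simp
  moreover have "B \<noteq> carrier H"
    using nB H.normal_self by blast
  ultimately show "B \<in> proper_nonnormal_subgroups H" by (simp add: proper_nonnormal_subgroups_def)
next
  fix B assume "B \<in> proper_nonnormal_subgroups H"
  then have s: "subgroup B H" "\<not> B \<lhd> H" by (auto simp: proper_nonnormal_subgroups_def)
  define A where "A = {x \<in> carrier G. h x \<in> B}"
  have sA: "subgroup A G"
    using s(1) unfolding A_def
    by (intro G.subgroupI) (auto simp: subgroup.m_closed subgroup.m_inv_closed subgroup.one_closed)
  have kA: "kernel G H h \<subseteq> A"
    using s(1) by (auto simp: A_def kernel_def subgroup.one_closed)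
  have B: "B = h ` A" using surj subgroup.subset[OF s(1)] by (auto simp: A_def)
  have nA: "\<not> A \<lhd> G" using normal_image_iff[OF sA kA surj] s(2) B by simp
  then have "A \<noteq> carrier G" using G.normal_self by blast
  with nA sA show "B \<in> (`) h ` proper_nonnormal_subgroups G"
    using B by (auto simp: proper_nonnormal_subgroups_def)
qed

lemma digraph_iso_Gamma_N:
  assumes surj: "h ` carrier G = carrier H"
    and ker: "\<And>A. A \<in> proper_nonnormal_subgroups G \<Longrightarrow> kernel G H h \<subseteq> A"
  shows "digraph_iso (with_proj (Gamma_N G)) (with_proj (Gamma_N H))"
proof -
  let ?V = "proper_nonnormal_subgroups G" and ?W = "proper_nonnormal_subgroups H"
  have bij: "bij_betw ((`) h) ?V ?W"
    using inj_on_image_proper_nonnormal_subgroups[OF ker] image_proper_nonnormal_subgroups[OF assms]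
    by (simp add: bij_betw_def)
  have "(A, B) \<in> parcs (Gamma_N G) \<longleftrightarrow> (h ` A, h ` B) \<in> parcs (Gamma_N H)"
    if AB: "A \<in> ?V" "B \<in> ?V" for A B
  proof -
    have "h ` A \<in> ?W" "h ` B \<in> ?W" using bij AB by (auto simp: bij_betw_def)
    \<comment> \<open>Adjacency demands distinct vertices, so injectivity on vertices is needed for
      the arcs too.\<close>
    moreover have "h ` A = h ` B \<longleftrightarrow> A = B"
      using bij AB by (auto simp: bij_betw_def inj_on_def)
    moreover have "subgroup A G" "subgroup B G" using AB by (auto simp: proper_nonnormal_subgroups_def)
    ultimately show ?thesis
      using permutable_image_iff ker AB by (simp add: Gamma_N_def)
  qed
  moreover have "pair_wf_digraph (Gamma_N G)" "pair_wf_digraph (Gamma_N H)"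
    by (unfold_locales; auto simp: Gamma_N_def)+
  ultimately show ?thesis
    using bij by (subst digraph_iso_with_proj_iff) (auto simp: Gamma_N_def)
qed

end

section \<open>Groups generated by an element and an inverting one\<close>

text \<open>Separates the computations with rotations \<open>a^i\<close> and reflections
  \<open>a^i b\<close> from words and their classes. The names are borrowed from the dihedral case;
  here a reflection squares to \<open>a^n\<close>.\<close>

locale inverting_generators = group G for G (structure) +
  fixes a b and n :: nat
  assumes a_closed [simp]: "a \<in> carrier G" and b_closed [simp]: "b \<in> carrier G"
    and generated: "carrier G = generate G {a, b}"
    and inverting: "a \<otimes> b = b \<otimes> inv a"
    and b_square: "b \<otimes> b = a [^] n"
begin

lemma b_int_pow: "b \<otimes> a [^] (i :: int) = a [^] (- i) \<otimes> b"
proof -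
  \<comment> \<open>Multiply \<open>inverting\<close> by \<open>inv a\<close> on the left and by
    \<open>a\<close> on the right.\<close>
  have 1: "b \<otimes> a = inv a \<otimes> b"
    by (metis a_closed b_closed inv_closed inv_solve_left inv_solve_right inverting m_assoc m_closed)
  have pos: "b \<otimes> a [^] (k :: nat) = inv (a [^] k) \<otimes> b" for k
  proof (induction k)
    case (Suc k)
    have "b \<otimes> a [^] Suc k = (b \<otimes> a [^] k) \<otimes> a" by (simp add: m_assoc)
    also have "\<dots> = inv (a [^] k) \<otimes> (b \<otimes> a)" by (simp add: Suc m_assoc)
    also have "\<dots> = inv (a [^] Suc k) \<otimes> b"
      unfolding nat_pow_Suc2[OF a_closed] by (simp add: 1 m_assoc[symmetric] inv_mult_group)
    finally show ?case .
  qed simp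
  have neg: "b \<otimes> inv (a [^] (k :: nat)) = a [^] k \<otimes> b" for k
    using pos[of k]
    by (metis a_closed b_closed inv_closed inv_solve_left inv_solve_right m_assoc m_closed nat_pow_closed)
  show ?thesis
    by (cases i rule: int_cases2) (simp_all add: int_pow_int int_pow_neg_int pos neg)
qed

text \<open>Moving \<open>b\<close> past \<open>a^j\<close> flips the sign of \<open>j\<close>, and
  the remaining \<open>b^2\<close> contributes the exponent \<open>n\<close>. For
  \<open>i = j\<close> this is the square of a reflection.\<close>

lemma reflection_mult:
  "(a [^] (i :: int) \<otimes> b) \<otimes> (a [^] (j :: int) \<otimes> b) = a [^] (i - j + int n)"
proof -
  have "(a [^] i \<otimes> b) \<otimes> (a [^] j \<otimes> b) = a [^] i \<otimes> (b \<otimes> a [^] j) \<otimes> b"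
    by (simp add: m_assoc)
  also have "\<dots> = a [^] i \<otimes> a [^] (- j) \<otimes> (b \<otimes> b)"
    by (simp add: b_int_pow m_assoc)
  also have "\<dots> = a [^] (i - j + int n)"
    by (simp add: b_square int_pow_mult[symmetric] int_pow_int[symmetric])
  finally show ?thesis .
qed

text \<open>The rotations and reflections together contain the generators and their inverses and are
  closed under products.\<close>

lemma normal_form:
  assumes "x \<in> carrier G"
  obtains (rotation) i :: int where "x = a [^] i" | (reflection) i :: int where "x = a [^] i \<otimes> b"
proof -
  have "x \<in> generate G {a, b}" using assms generated by simp
  then have "(\<exists>i::int. x = a [^] i) \<or> (\<exists>i::int. x = a [^] i \<otimes> b)"
  proof (induction rule: generate.induct)
    case one
    show ?case by (auto intro: exI[of _ 0])
  next
    case (incl x)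
    have "a = a [^] (1::int)" "b = a [^] (0::int) \<otimes> b" by (simp_all add: int_pow_1)
    then show ?case using incl by blast
  next
    case (inv x)
    have "inv a = a [^] (- 1 :: int)" by (simp add: int_pow_neg int_pow_1)
    \<comment> \<open>The inverse of \<open>b\<close> must itself be a reflection; since
      \<open>b^2 = a^n\<close>, it is \<open>a^(-n) b\<close>.\<close>
    moreover have "(a [^] (- int n) \<otimes> b) \<otimes> b = \<one>"
      using reflection_mult[of "- int n" 0] by simp
    then have "inv b = a [^] (- int n) \<otimes> b" by (intro inv_equality) auto
    ultimately show ?case using inv by blast
  next
    case (eng x y)
    have rr: "a [^] i \<otimes> a [^] j = a [^] (i + j)" for i j :: int
      by (simp add: int_pow_mult)
    have rs: "a [^] i \<otimes> (a [^] j \<otimes> b) = a [^] (i + j) \<otimes> b" for i j :: int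
      by (simp add: int_pow_mult m_assoc)
    have sr: "a [^] i \<otimes> b \<otimes> a [^] j = a [^] (i - j) \<otimes> b" for i j :: int
      using b_int_pow[of j] int_pow_mult[of a i "- j"] by (simp add: m_assoc)
    from eng.IH show ?case
      by (elim disjE exE) (simp_all only: rr rs sr reflection_mult, blast+)
  qed
  with that show ?thesis by blast
qed

text \<open>As a power of \<open>a\<close> this element commutes with \<open>a\<close>, and as
  \<open>b^2\<close> it commutes with \<open>b\<close>.\<close>

lemma b_square_central:
  assumes "x \<in> carrier G"
  shows "a [^] n \<otimes> x = x \<otimes> a [^] n"
proof -
  have a: "a [^] n \<otimes> a [^] i = a [^] i \<otimes> a [^] n" for i :: int
    by (simp add: int_pow_mult[symmetric] int_pow_int[symmetric] add.commute)
  have b: "a [^] n \<otimes> b = b \<otimes> a [^] n"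
    by (simp add: b_square[symmetric] m_assoc)
  show ?thesis using assms
  proof (cases rule: normal_form)
    case (rotation i)
    then show ?thesis using a by simp
  next
    case (reflection i)
    have "a [^] n \<otimes> (a [^] i \<otimes> b) = a [^] i \<otimes> (a [^] n \<otimes> b)"
      using a[of i] by (simp add: m_assoc[symmetric])
    then show ?thesis using reflection b by (simp add: m_assoc)
  qed
qed

text \<open>Conjugation by a rotation fixes \<open>a^j\<close>, and conjugation by a reflection
  inverts it; a subgroup is closed under both.\<close>

lemma normal_if_subset_rotations:
  assumes A: "subgroup A G" and rot: "A \<subseteq> range (\<lambda>i::int. a [^] i)"
  shows "A \<lhd> G"
proof -
  have "x \<otimes> y \<otimes> inv x \<in> A" if x: "x \<in> carrier G" and y: "y \<in> A" for x y
  proof -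
    from y rot obtain j :: int where j: "y = a [^] j" by blast
    have i_commute: "a [^] i \<otimes> a [^] k = a [^] k \<otimes> a [^] i" for i k :: int
      by (simp add: int_pow_mult[symmetric] add.commute)
    from x show ?thesis
    proof (cases rule: normal_form)
      case (rotation i)
      then have "x \<otimes> y \<otimes> inv x = y"
        using i_commute[of i j] j by (simp add: m_assoc)
      then show ?thesis using y by simp
    next
      case (reflection i)
      have "x \<otimes> y = a [^] i \<otimes> (b \<otimes> a [^] j)" by (simp add: reflection j m_assoc)
      also have "\<dots> = a [^] (- j) \<otimes> x"
        using i_commute[of i "- j"] by (simp add: reflection b_int_pow m_assoc[symmetric])
      finally have "x \<otimes> y \<otimes> inv x = inv y"
        using x by (simp add: m_assoc j int_pow_neg)
      then show ?thesis using A y by (simp add: subgroup.m_inv_closed)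
    qed
  qed
  then show ?thesis using A by (simp add: normal_inv_iff)
qed

lemma b_square_mem_nonnormal_subgroup:
  assumes A: "subgroup A G" "\<not> A \<lhd> G"
  shows "a [^] n \<in> A"
proof -
  obtain x where x: "x \<in> A" "x \<notin> range (\<lambda>i::int. a [^] i)"
    using normal_if_subset_rotations A by blast
  then have "x \<in> carrier G" using A(1) subgroup.subset by blast
  then obtain i :: int where "x = a [^] i \<otimes> b"
    using x(2) by (cases rule: normal_form) auto
  then have "x \<otimes> x = a [^] n" using reflection_mult[of i i] by (simp add: int_pow_int)
  then show ?thesis using A(1) x(1) by (metis subgroup.m_closed)
qed

end

section \<open>Presented groups\<close>

lemma carrier_presented_group: "carrier (presented_group R) = range (word_class R)"
  by (simp add: presented_group_def)

lemma word_class_closed [simp]: "word_class R u \<in> carrier (presented_group R)"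
  by (simp add: carrier_presented_group)

lemma one_presented_group: "\<one>\<^bsub>presented_group R\<^esub> = word_class R []"
  by (simp add: presented_group_def)

lemma word_class_replicate:
  "word_class R (replicate k x) = word_class R [x] [^]\<^bsub>presented_group R\<^esub> k"
proof (induction k)
  case 0
  then show ?case by (simp add: one_presented_group)
next
  case (Suc k)
  have "word_class R (replicate (Suc k) x) = word_class R (replicate k x @ [x])"
    by (simp add: replicate_append_same)
  then show ?case using Suc by (simp add: presented_group_mult[symmetric])
qed

lemma word_class_GenInv:
  "word_class R [GenInv x] = inv\<^bsub>presented_group R\<^esub> word_class R [Gen x]"
proof -
  interpret group "presented_group R" by (rule group_presented_group)
  show ?thesis
    by (rule inv_equality[symmetric])
      (simp_all add: presented_group_mult one_presented_group word_class_eq_iff word_eq.cancel')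
qed

text \<open>Induction on words: the class of a letter is a generator or the inverse of one. This
  supplies the assumption \<open>generated\<close> for the dicyclic group.\<close>

lemma generate_presented_group:
  "carrier (presented_group R) = generate (presented_group R) (range (\<lambda>x. word_class R [Gen x]))"
proof -
  interpret group "presented_group R" by (rule group_presented_group)
  let ?S = "range (\<lambda>x. word_class R [Gen x])"
  have letter: "word_class R [l] \<in> generate (presented_group R) ?S" for l
    by (cases l) (auto simp: word_class_GenInv intro: generate.incl generate.inv)
  have "word_class R u \<in> generate (presented_group R) ?S" for u
  proof (induction u)
    case Nil
    show ?case using generate.one[of "presented_group R"] by (simp add: one_presented_group)
  next
    case (Cons l u)
    have "word_class R (l # u) = word_class R [l] \<otimes>\<^bsub>presented_group R\<^esub> word_class R u"
      by (simp add: presented_group_mult)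
    then show ?case using generate.eng[OF letter Cons] by simp
  qed
  moreover have "generate (presented_group R) ?S \<subseteq> carrier (presented_group R)"
    by (rule generate_incl) auto
  ultimately show ?thesis by (auto simp: carrier_presented_group)
qed

lemma range_gen: "range f = {f gen_a, f gen_b}"
proof -
  have "(UNIV :: gen set) = {gen_a, gen_b}" using gen.exhaust by blast
  then show ?thesis by (metis image_empty image_insert)
qed

lemma word_eq_mono:
  assumes "word_eq R u v" and "\<And>u v. (u, v) \<in> R \<Longrightarrow> word_eq S u v"
  shows "word_eq S u v"
  using assms(1) by induction (auto intro: assms(2) word_eq.intros)

text \<open>Von Dyck's theorem for presentations on the same generators: if the relations
  \<open>R\<close> hold modulo \<open>S\<close>, the identity on words induces a
  homomorphism.\<close>

lemma group_hom_presented_group: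
  assumes "\<And>u v. (u, v) \<in> R \<Longrightarrow> word_eq S u v"
  obtains h where "group_hom (presented_group R) (presented_group S) h"
    "\<And>u. h (word_class R u) = word_class S u"
proof -
  \<comment> \<open>The chosen representative does not matter on classes: by
    \<open>word_eq_mono\<close>, words equal modulo \<open>R\<close> are equal modulo
    \<open>S\<close>.\<close>
  define h where "h X = word_class S (SOME u. X = word_class R u)" for X
  have h: "h (word_class R u) = word_class S u" for u
  proof -
    have "word_class R u = word_class R (SOME v. word_class R u = word_class R v)"
      by (rule someI[of _ u]) simp
    then show ?thesis
      unfolding h_def word_class_eq_iff by (metis word_eq_mono assms word_eq.sym)
  qed
  have "h \<in> hom (presented_group R) (presented_group S)"
    by (auto simp: hom_def carrier_presented_group presented_group_mult h)
  then have "group_hom (presented_group R) (presented_group S) h"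
    by (simp add: group_hom_def group_hom_axioms_def group_presented_group)
  with h that show ?thesis by blast
qed

section \<open>The dihedral group as a quotient of the dicyclic group\<close>

text \<open>Naming the relation sets lets the congruences of the two presentations be compared on
  the same words.\<close>

definition dihedral_rel :: "nat \<Rightarrow> (gen letter list \<times> gen letter list) set" where
  "dihedral_rel n =
     {(replicate n (Gen gen_a), []),
      (replicate 2 (Gen gen_b), []),
      ([Gen gen_a, Gen gen_b], [Gen gen_b, GenInv gen_a])}"

definition quaternion_rel :: "nat \<Rightarrow> (gen letter list \<times> gen letter list) set" where
  "quaternion_rel n =
     {(replicate (2 * n) (Gen gen_a), []),
      (replicate 4 (Gen gen_b), []),
      (replicate 2 (Gen gen_b), replicate n (Gen gen_a)),
      ([Gen gen_a, Gen gen_b], [Gen gen_b, GenInv gen_a])}"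

lemma dihedral_group_eq: "dihedral_group n = presented_group (dihedral_rel n)"
  by (simp add: dihedral_group_def dihedral_rel_def)

lemma quaternion_group_eq: "quaternion_group n = presented_group (quaternion_rel n)"
  by (simp add: quaternion_group_def quaternion_rel_def)

lemma word_eq_dihedral_if_quaternion_rel:
  assumes "(u, v) \<in> quaternion_rel n"
  shows "word_eq (dihedral_rel n) u v"
proof -
  let ?D = "dihedral_rel n"
  have a: "word_eq ?D (replicate n (Gen gen_a)) []"
    and b: "word_eq ?D (replicate 2 (Gen gen_b)) []"
    and ab: "word_eq ?D [Gen gen_a, Gen gen_b] [Gen gen_b, GenInv gen_a]"
    by (auto intro!: word_eq.rel simp: dihedral_rel_def)
  have "word_eq ?D (replicate (2 * n) (Gen gen_a)) []"
    using word_eq.append[OF a a] by (simp add: replicate_add[symmetric] mult_2)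
  moreover have "word_eq ?D (replicate 4 (Gen gen_b)) []"
    using word_eq.append[OF b b] by (simp add: replicate_add[symmetric])
  moreover have "word_eq ?D (replicate 2 (Gen gen_b)) (replicate n (Gen gen_a))"
    using a b by (blast intro: word_eq.sym word_eq.trans)
  ultimately show ?thesis using assms ab by (auto simp: quaternion_rel_def)
qed

lemma inverting_generators_quaternion:
  "inverting_generators (presented_group (quaternion_rel n))
     (word_class (quaternion_rel n) [Gen gen_a]) (word_class (quaternion_rel n) [Gen gen_b]) n"
proof -
  let ?Q = "quaternion_rel n"
  interpret group "presented_group ?Q" by (rule group_presented_group)
  have "word_eq ?Q [Gen gen_a, Gen gen_b] [Gen gen_b, GenInv gen_a]"
    and "word_eq ?Q (replicate 2 (Gen gen_b)) (replicate n (Gen gen_a))"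
    by (auto intro!: word_eq.rel simp: quaternion_rel_def)
  then show ?thesis
    by unfold_locales
      (simp_all add: generate_presented_group range_gen presented_group_mult word_class_eq_iff
        word_class_GenInv[symmetric] word_class_replicate[symmetric] numeral_2_eq_2 generate.incl)
qed

text \<open>Equality up to a factor \<open>z = a^n\<close> is a congruence on words, because
  \<open>z\<close> is central and \<open>z^2 = 1\<close>. It contains the dihedral relations, so it
  contains everything derivable from them. With \<open>v = []\<close> this bounds the
  kernel.\<close>

lemma quaternion_word_eq_if_dihedral_word_eq:
  assumes "word_eq (dihedral_rel n) u v"
  defines "Q \<equiv> quaternion_rel n"
  shows "word_eq Q u v \<or> word_eq Q u (replicate n (Gen gen_a) @ v)"
proof -
  let ?G = "presented_group Q"
  let ?c = "word_class Q"
  interpret inverting_generators ?G "?c [Gen gen_a]" "?c [Gen gen_b]" n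
    unfolding Q_def by (rule inverting_generators_quaternion)
  define z where "z = ?c (replicate n (Gen gen_a))"
  have z: "z \<in> carrier ?G" by (simp add: z_def)
  have zz: "z \<otimes>\<^bsub>?G\<^esub> z = \<one>\<^bsub>?G\<^esub>"
  proof -
    have "word_eq Q (replicate (2 * n) (Gen gen_a)) []"
      by (auto intro: word_eq.rel simp: Q_def quaternion_rel_def)
    then show ?thesis
      by (simp add: z_def presented_group_mult one_presented_group word_class_eq_iff
          replicate_add[symmetric] mult_2)
  qed
  have central: "z \<otimes>\<^bsub>?G\<^esub> x = x \<otimes>\<^bsub>?G\<^esub> z" if "x \<in> carrier ?G" for x
    using b_square_central[OF that] by (simp add: z_def word_class_replicate)
  have zz': "z \<otimes>\<^bsub>?G\<^esub> (z \<otimes>\<^bsub>?G\<^esub> x) = x" if "x \<in> carrier ?G" for x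
    using zz z that by (simp add: m_assoc[symmetric])
  have swap: "x \<otimes>\<^bsub>?G\<^esub> (z \<otimes>\<^bsub>?G\<^esub> y) = z \<otimes>\<^bsub>?G\<^esub> (x \<otimes>\<^bsub>?G\<^esub> y)"
    if "x \<in> carrier ?G" "y \<in> carrier ?G" for x y
    using central[OF that(1)] z that by (simp add: m_assoc[symmetric])
  have "?c u = ?c v \<or> ?c u = z \<otimes>\<^bsub>?G\<^esub> ?c v"
    using assms(1)
  proof induction
    \<comment> \<open>Both \<open>a^n\<close> and \<open>b^2\<close> equal \<open>z\<close> times
      the identity; the third relation is shared by the two presentations.\<close>
    case (rel u v)
    have "word_eq Q [Gen gen_a, Gen gen_b] [Gen gen_b, GenInv gen_a]"
      "word_eq Q (replicate 2 (Gen gen_b)) (replicate n (Gen gen_a))"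
      by (auto intro!: word_eq.rel simp: Q_def quaternion_rel_def)
    with rel show ?case
      by (auto simp: dihedral_rel_def z_def presented_group_mult word_class_eq_iff
          intro: word_eq.refl)
  next
    case (trans u v w)
    then show ?case using zz' by auto
  next
    case (append u u' v v')
    have e: "?c (u @ v) = ?c u \<otimes>\<^bsub>?G\<^esub> ?c v" "?c (u' @ v') = ?c u' \<otimes>\<^bsub>?G\<^esub> ?c v'"
      by (simp_all add: presented_group_mult)
    \<comment> \<open>A factor \<open>z\<close> on the left operand comes out by associativity, one
      on the right operand by \<open>swap\<close>; if both occur, they cancel by
      \<open>zz'\<close>.\<close>
    have "(z \<otimes>\<^bsub>?G\<^esub> ?c u') \<otimes>\<^bsub>?G\<^esub> y = z \<otimes>\<^bsub>?G\<^esub> (?c u' \<otimes>\<^bsub>?G\<^esub> y)"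
      if "y \<in> carrier ?G" for y
      using z that by (simp add: m_assoc)
    moreover note swap[of "?c u'" "?c v'"] zz'[of "?c u' \<otimes>\<^bsub>?G\<^esub> ?c v'"]
    ultimately show ?case
      using append.IH z unfolding e by (elim disjE) simp_all
  \<comment> \<open>Among the remaining cases only symmetry needs \<open>zz'\<close>: from
    \<open>u = z v\<close> it follows that \<open>v = z u\<close>.\<close>
  qed (use zz' in \<open>auto simp: word_class_eq_iff intro: word_eq.intros\<close>)
  then show ?thesis
    by (simp add: z_def presented_group_mult word_class_eq_iff)
qed

theorem theorem5p1:
  fixes n :: nat
  assumes "n \<ge> 3"
  shows "digraph_iso (with_proj (Gamma_N (quaternion_group n)))
                     (with_proj (Gamma_N (dihedral_group n)))"
proof -
  let ?Q = "quaternion_rel n" and ?D = "dihedral_rel n"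
  let ?a = "word_class ?Q [Gen gen_a]"
  obtain h where hom: "group_hom (presented_group ?Q) (presented_group ?D) h"
    and h: "\<And>u. h (word_class ?Q u) = word_class ?D u"
    using group_hom_presented_group word_eq_dihedral_if_quaternion_rel by metis
  interpret group_hom "presented_group ?Q" "presented_group ?D" h by (rule hom)
  interpret inverting_generators "presented_group ?Q" ?a "word_class ?Q [Gen gen_b]" n
    by (rule inverting_generators_quaternion)
  have "kernel (presented_group ?Q) (presented_group ?D) h
      \<subseteq> {\<one>\<^bsub>presented_group ?Q\<^esub>, ?a [^]\<^bsub>presented_group ?Q\<^esub> n}"
  proof
    fix x assume "x \<in> kernel (presented_group ?Q) (presented_group ?D) h"
    then obtain u where u: "x = word_class ?Q u" "word_class ?D u = word_class ?D []"
      by (auto simp: kernel_def carrier_presented_group one_presented_group h)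
    then have "word_eq ?D u []" by (simp add: word_class_eq_iff)
    from quaternion_word_eq_if_dihedral_word_eq[OF this]
    show "x \<in> {\<one>\<^bsub>presented_group ?Q\<^esub>, ?a [^]\<^bsub>presented_group ?Q\<^esub> n}"
      by (simp add: u(1) one_presented_group word_class_replicate[symmetric] word_class_eq_iff)
  qed
  \<comment> \<open>Both possible kernel elements lie in every vertex: the identity in any subgroup,
    \<open>a^n\<close> in any non-normal one.\<close>
  then have "kernel (presented_group ?Q) (presented_group ?D) h \<subseteq> A"
    if "A \<in> proper_nonnormal_subgroups (presented_group ?Q)" for A
    using that b_square_mem_nonnormal_subgroup[of A] subgroup.one_closed[of A]
    by (auto simp: proper_nonnormal_subgroups_def)
  \<comment> \<open>Both groups consist of classes of the same words, and \<open>h\<close> sends the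
    class of \<open>u\<close> to the class of \<open>u\<close>.\<close>
  moreover have "h ` carrier (presented_group ?Q) = carrier (presented_group ?D)"
    by (auto simp: carrier_presented_group h image_image)
  ultimately show ?thesis
    unfolding quaternion_group_eq dihedral_group_eq by (intro digraph_iso_Gamma_N)
qed

end
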